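(* Let $f : \mathbb{C} \to \mathbb{C}$ be an entire function satisfying $$\underline{\tau} := \liminf_{r \to \infty} \frac{\log \max_{|z| = r} |f(z)|}{r^2} < \infty$$ and let $g \in \mathbb{C}[z]$ be a polynomial of degree $q \in \mathbb{N}_0$. Let $\Lambda \subset \mathbb{C}$ be a uniformly discrete set with lower Beurling density $D^{-}(\Lambda) > 2\underline{\tau}/\pi$. 1. If there exists a constant $c > 0$ such that $|f(\lambda)| \leq c\,|g(\lambda)|$ for all $\lambda \in \Lambda$, then $f \in \mathbb{C}[z]$ is a polynomial of degree $q$. 2. Moreover, $f \sim g$ if and only if $|f| = |g|$ on $\Lambda$.
   Context: Here $\mathbb{N}_0 = \{0,1,2,\dots\}$ and $\mathbb{C}[z]$ denotes the polynomials with complex coefficients. Two functions satisfy $f \sim g$ if there exists $\sigma \in \mathbb{C}$ with $|\sigma| = 1$ and $f = \sigma g$. A discrete set $\Lambda = \{\lambda_j\}_{j=1}^\infty \subset \mathbb{C}$ is uniformly discrete if $\inf_{j \neq k} |\lambda_j - \lambda_k| > 0$. Its lower Beurling density is $$D^{-}(\Lambda) := \liminf_{r \to \infty} \frac{\inf_{z_0 \in \mathbb{C}} |\Lambda \cap (rK + z_0)|}{r^2},$$ where $|\cdot|$ applied to a set denotes cardinality and $K \subset \mathbb{C}$ is a compact set of unit measure; the definition is independent of the particular choice of $K$.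
   Formalization: In part 1, "polynomial of degree q" is stated as "polynomial of degree at most q", because exact degree q fails, e.g. for f = 1, g = z and Λ = Z² + (1+i)/2. *)

theory Defs
  imports "HOL-Complex_Analysis.Complex_Analysis"
begin

definition max_modulus :: "(complex \<Rightarrow> complex) \<Rightarrow> real \<Rightarrow> real" where
  "max_modulus f r = (SUP z\<in>sphere 0 r. cmod (f z))"

text \<open>Logarithm with the convention that the logarithm of 0 is minus infinity, which matters only for
  the zero function (the library's real logarithm satisfies \<^term>\<open>ln (0::real) = 0\<close>).\<close>

definition ext_ln :: "real \<Rightarrow> ereal" where
  "ext_ln x = (if x = 0 then -\<infinity> else ereal (ln x))"

definition lower_type :: "(complex \<Rightarrow> complex) \<Rightarrow> ereal" where
  "lower_type f = Liminf at_top (\<lambda>r::real. ext_ln (max_modulus f r) / ereal (r\<^sup>2))"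

text \<open>The lower Beurling density relative to a reference set \<open>K\<close>, meant to be compact of unit
  measure.  If \<open>\<Lambda>\<close> is uniformly discrete, the sets that are counted are finite, so \<^const>\<open>card\<close>
  is the true cardinality.\<close>

definition lower_beurling_density :: "complex set \<Rightarrow> complex set \<Rightarrow> ereal" where
  "lower_beurling_density K \<Lambda> =
     Liminf at_top (\<lambda>r::real.
       ereal ((INF z0. real (card (\<Lambda> \<inter> (\<lambda>z. of_real r * z + z0) ` K))) / r\<^sup>2))"

definition phase_equiv :: "(complex \<Rightarrow> complex) \<Rightarrow> (complex \<Rightarrow> complex) \<Rightarrow> bool" where
  "phase_equiv f g \<longleftrightarrow> (\<exists>\<sigma>. cmod \<sigma> = 1 \<and> (\<forall>z. f z = \<sigma> * g z))"

end

theory Submission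
  imports Defs "HOL-Real_Asymp.Real_Asymp"
begin

text \<open>Local estimate: on a disc of fixed radius \<open>R\<close> about \<open>w\<close>, subtract from \<open>f\<close> the Lagrange polynomial
  interpolating it on \<open>\<Lambda>\<close> and divide by the Blaschke product of \<open>\<Lambda>\<close>; if the density of \<open>\<Lambda>\<close> exceeds
  \<open>2 b / \<pi>\<close>, this product is at most about \<open>exp (- b R\<^sup>2)\<close> at \<open>w\<close>, so \<open>|f w|\<close> is bounded by
  \<open>exp (- b R\<^sup>2)\<close> times the maximum of \<open>|f|\<close> on the circle plus a constant times its maximum on \<open>\<Lambda>\<close>.
  For the weight \<open>exp (- \<beta> |z - v|\<^sup>2)\<close> with lower type \<open>< \<beta> < b\<close> the first term is absorbed at a maximum
  point of the weighted function, and the growth along a sequence of radii keeps this point away from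
  the boundary. Hence \<open>|f v|\<close> is bounded by a constant times the supremum of
  \<open>|f \<lambda>| exp (- \<beta> |\<lambda> - v|\<^sup>2)\<close> over \<open>\<Lambda>\<close>; this has polynomial growth in \<open>v\<close>, and Liouville's theorem
  applies. For the second part, \<open>|f|\<^sup>2 - |g|\<^sup>2\<close> is then a real polynomial in the real and imaginary
  part of \<open>z\<close> that vanishes on a relatively dense set, hence everywhere.\<close>

section \<open>Counting points of a uniformly discrete set in discs\<close>

lemma uniform_discrete_finite_cball:
  fixes L :: "complex set"
  assumes "uniform_discrete L"
  shows "finite (L \<inter> cball w r)"
proof -
  obtain e where "e > 0" and e: "\<And>x y. \<lbrakk>x \<in> L; y \<in> L; dist x y < e\<rbrakk> \<Longrightarrow> x = y"
    using assms unfolding uniform_discrete_def by blast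
  have "\<not> x islimpt (L \<inter> cball w r)" for x
    using \<open>e > 0\<close> e by (intro discrete_imp_not_islimpt[of e]) (auto simp: dist_commute)
  then show ?thesis
    using Heine_Borel_imp_Bolzano_Weierstrass[OF compact_cball[of w r]] by blast
qed

text \<open>Balls of radius \<open>e/2\<close> contain at most one point of \<open>L\<close>. One
  finite cover of the disc about 0, translated to \<open>w\<close>, makes the bound independent of
  \<open>w\<close>.\<close>

lemma uniform_discrete_card_cball_bounded:
  fixes L :: "complex set"
  assumes "uniform_discrete L"
  obtains k where "\<And>w. card (L \<inter> cball w R) \<le> k"
proof -
  obtain e where "e > 0" and e: "\<And>x y. \<lbrakk>x \<in> L; y \<in> L; dist x y < e\<rbrakk> \<Longrightarrow> x = y"
    using assms unfolding uniform_discrete_def by blast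
  obtain T where T: "finite T" "cball (0::complex) R \<subseteq> (\<Union>x\<in>T. ball x (e/2))"
    using compact_eq_totally_bounded[of "cball (0::complex) R"] \<open>e > 0\<close>
    by (metis compact_cball half_gt_zero)
  have "card (L \<inter> cball w R) \<le> card T" for w
  proof -
    have "\<exists>t\<in>T. z - w \<in> ball t (e/2)" if "z \<in> L \<inter> cball w R" for z
    proof -
      have "z - w \<in> cball 0 R" using that by (simp add: dist_norm norm_minus_commute)
      then show ?thesis using T by blast
    qed
    then obtain h where h: "\<And>z. z \<in> L \<inter> cball w R \<Longrightarrow> h z \<in> T \<and> z - w \<in> ball (h z) (e/2)"
      by metis
    have "inj_on h (L \<inter> cball w R)"
    proof (rule inj_onI)
      fix x y assume xy: "x \<in> L \<inter> cball w R" "y \<in> L \<inter> cball w R" "h x = h y"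
      have "dist (x - w) (y - w) < e"
        using h[OF xy(1)] h[OF xy(2)] xy(3) by (simp add: dist_commute dist_triangle_half_l[of "h x"] dist_triangle_half_r[of "h x"])
      then show "x = y" using e xy by (simp add: dist_norm)
    qed
    then show ?thesis
      using T(1) h by (meson card_inj_on_le image_subsetI)
  qed
  then show ?thesis using that by blast
qed

text \<open>Averaging the count over all translates centred in a disc replaces the reference set by discs.\<close>

lemma card_cball_ge_of_card_translates:
  fixes L K :: "complex set"
  assumes K: "compact K" "measure lborel K = 1" and r: "r > 0"
    and L: "uniform_discrete L"
    and count: "\<And>z0. d * r\<^sup>2 \<le> real (card (L \<inter> (\<lambda>z. of_real r * z + z0) ` K))"
  obtains s where "\<And>w t. t \<ge> 0 \<Longrightarrow> d * pi * t\<^sup>2 \<le> real (card (L \<inter> cball w (t + s)))"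
proof -
  obtain \<rho> where \<rho>: "\<And>z. z \<in> K \<Longrightarrow> norm z \<le> \<rho>"
    using compact_imp_bounded[OF K(1)] bounded_iff by blast
  have "d * pi * t\<^sup>2 \<le> real (card (L \<inter> cball w (t + r * \<rho>)))" if t: "t \<ge> 0" for w t
  proof -
    define S where "S = L \<inter> cball w (t + r * \<rho>)"
    \<comment> \<open>\<open>A l\<close> is the set of shifts \<open>z0\<close> for which
      \<open>l\<close> lies in \<open>r K + z0\<close>; as an affine copy of \<open>K\<close> it has
      area \<open>r\<^sup>2\<close> for every \<open>l\<close>.\<close>
    define A where "A l = (\<lambda>z. (- r) *\<^sub>R z + l) ` K" for l :: complex
    have finS: "finite S" unfolding S_def using L by (rule uniform_discrete_finite_cball)
    have cA: "compact (A l)" for l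
      unfolding A_def by (intro compact_continuous_image continuous_intros K)
    then have lA: "A l \<in> lmeasurable" for l by (rule lmeasurable_compact)
    have iA: "integrable lebesgue (indicator (A l) :: complex \<Rightarrow> real)" for l
      using lA[of l] by (intro integrable_real_indicator) (auto simp: fmeasurable_def simp del: emeasure_completion)
    have mA: "measure lebesgue (A l) = r\<^sup>2" for l
    proof -
      have "K \<in> sets lborel" using K(1) by (simp add: borel_compact)
      then have "measure lebesgue K = 1" using K(2) by simp
      then show ?thesis
        unfolding A_def using measure_lebesgue_affine[of "-r" l K] by simp
    qed
    \<comment> \<open>For \<open>z0\<close> in the disc, the points of \<open>L\<close> in
      \<open>r K + z0\<close> lie within \<open>r * \<rho>\<close> of \<open>z0\<close>, hence in
      \<open>S\<close>, so the right side counts all of them. Integration over \<open>z0\<close>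
      then compares areas.\<close>
    have pt: "d * r\<^sup>2 * indicator (cball w t) z0 \<le> (\<Sum>l\<in>S. indicator (A l) z0 :: real)" for z0
    proof (cases "z0 \<in> cball w t")
      case True
      have sub: "L \<inter> (\<lambda>z. of_real r * z + z0) ` K \<subseteq> {l\<in>S. z0 \<in> A l}"
      proof
        fix l assume "l \<in> L \<inter> (\<lambda>z. of_real r * z + z0) ` K"
        then obtain z where z: "l \<in> L" "z \<in> K" "l = of_real r * z + z0" by blast
        have "dist w l \<le> dist w z0 + dist z0 l" by (rule dist_triangle)
        also have "dist z0 l \<le> r * \<rho>"
          using \<rho>[OF z(2)] r by (simp add: z(3) dist_norm norm_mult mult_left_mono)
        finally have "l \<in> S" unfolding S_def using True z(1) by simp
        moreover have "z0 \<in> A l"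
          unfolding A_def by (rule image_eqI[OF _ z(2)]) (simp add: z(3) scaleR_conv_of_real)
        ultimately show "l \<in> {l\<in>S. z0 \<in> A l}" by simp
      qed
      have "d * r\<^sup>2 \<le> real (card {l\<in>S. z0 \<in> A l})"
        using count[of z0] card_mono[OF _ sub] finS by fastforce
      also have "\<dots> = (\<Sum>l\<in>S. indicator (A l) z0)"
        using finS by (simp add: indicator_def sum.If_cases Int_def)
      finally show ?thesis using True by simp
    qed (simp add: sum_nonneg)
    have "(\<integral>z0. d * r\<^sup>2 * indicator (cball w t) z0 \<partial>lebesgue) \<le> (\<integral>z0. (\<Sum>l\<in>S. indicator (A l) z0 :: real) \<partial>lebesgue)"
    proof (rule integral_mono)
      show "integrable lebesgue (\<lambda>z0. d * r\<^sup>2 * indicator (cball w t) z0)"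
        using lmeasurable_cball[of w t] 
        by (intro integrable_mult_right) (simp add: fmeasurable_def)
      show "integrable lebesgue (\<lambda>z0. \<Sum>l\<in>S. indicator (A l) z0 :: real)"
        by (intro Bochner_Integration.integrable_sum iA)
    qed (rule pt)
    also have "(\<integral>z0. (\<Sum>l\<in>S. indicator (A l) z0 :: real) \<partial>lebesgue) = (\<Sum>l\<in>S. measure lebesgue (A l))"
      by (simp add: Bochner_Integration.integral_sum iA)
    also have "\<dots> = r\<^sup>2 * real (card S)" by (simp add: mA)
    also have "(\<integral>z0. d * r\<^sup>2 * indicator (cball w t) z0 \<partial>lebesgue) = d * r\<^sup>2 * (pi * t\<^sup>2)"
      using t by (simp add: content_cball unit_ball_vol_2)
    finally show ?thesis using r unfolding S_def by (simp add: algebra_simps)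
  qed
  then show ?thesis using that by blast
qed

text \<open>A single scale \<open>r\<close> at which every translate holds at least
  \<open>d * r\<^sup>2\<close> points suffices, because averaging turns it into a bound for all
  radii \<open>t\<close>.\<close>

lemma lower_beurling_density_card_cball:
  fixes L K :: "complex set"
  assumes "compact K" "measure lborel K = 1" "uniform_discrete L"
    and d: "ereal d < lower_beurling_density K L"
  obtains s where "\<And>w t. t \<ge> 0 \<Longrightarrow> d * pi * t\<^sup>2 \<le> real (card (L \<inter> cball w (t + s)))"
proof -
  define c where "c r z0 = real (card (L \<inter> (\<lambda>z. of_real r * z + z0) ` K))" for r z0
  have "\<forall>\<^sub>F r::real in at_top. ereal d < ereal ((INF z0. c r z0) / r\<^sup>2)"
    using d unfolding lower_beurling_density_def c_def by (rule less_LiminfD)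
  then have "\<forall>\<^sub>F r::real in at_top. ereal d < ereal ((INF z0. c r z0) / r\<^sup>2) \<and> r > 0"
    using eventually_gt_at_top[of 0] by (rule eventually_conj)
  then obtain r where r: "d < (INF z0. c r z0) / r\<^sup>2" "r > 0"
    using eventually_happens by fastforce
  have "d * r\<^sup>2 \<le> c r z0" for z0
  proof -
    have "d * r\<^sup>2 \<le> (INF z0. c r z0)" using r by (simp add: field_simps)
    also have "\<dots> \<le> c r z0"
      by (rule cINF_lower) (auto simp: c_def intro!: bdd_belowI[of _ 0])
    finally show ?thesis .
  qed
  then show ?thesis
    using card_cball_ge_of_card_translates[OF assms(1,2) r(2) assms(3)] that unfolding c_def by blast
qed

section \<open>Blaschke products, Lagrange interpolation and the local estimate\<close>

text \<open>The discrete form of the Jensen integral: \<open>\<Sum> ln (R / |l|) = \<integral> n(t)/t dt\<close>.\<close>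

lemma prod_norm_le_exp:
  fixes S :: "complex set"
  assumes S: "finite S" "S \<subseteq> cball w R" and t0: "0 < t0" "t0 \<le> R"
    and count: "\<And>t. t0 \<le> t \<Longrightarrow> t \<le> R \<Longrightarrow> 2 * b * t\<^sup>2 \<le> real (card (S \<inter> cball w t))"
  shows "(\<Prod>l\<in>S. cmod (w - l) / R) \<le> exp (- b * (R\<^sup>2 - t0\<^sup>2))"
proof -
  \<comment> \<open>Truncation at \<open>t0\<close> keeps the logarithm finite when \<open>w\<close>
    itself belongs to \<open>S\<close>, and confines the integral to radii where
    \<open>count\<close> applies.\<close>
  define m where "m l = max t0 (cmod (w - l))" for l
  have m: "t0 \<le> m l" "0 < m l" "l \<in> S \<Longrightarrow> m l \<le> R" for l
    using t0 S(2) by (auto simp: m_def dist_norm)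
  have one: "((\<lambda>t. if t \<in> {m l..R} then 1 / t else 0) has_integral ln (R / m l)) {t0..R}"
    if "l \<in> S" for l
  proof -
    have "((\<lambda>t. 1 / t) has_integral (ln R - ln (m l))) {m l..R}"
      using m[of l] that
      by (intro fundamental_theorem_of_calculus)
         (auto simp: has_real_derivative_iff_has_vector_derivative[symmetric] intro!: derivative_eq_intros)
    then show ?thesis
      using m[of l] that t0 by (subst has_integral_restrict) (auto simp: ln_div)
  qed
  have int: "((\<lambda>t. \<Sum>l\<in>S. if t \<in> {m l..R} then 1 / t else 0) has_integral (\<Sum>l\<in>S. ln (R / m l))) {t0..R}"
    using S(1) one by (rule has_integral_sum)
  have quad: "((\<lambda>t. 2 * b * t) has_integral (b * R\<^sup>2 - b * t0\<^sup>2)) {t0..R}"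
    using t0 by (intro fundamental_theorem_of_calculus)
      (auto simp: has_real_derivative_iff_has_vector_derivative[symmetric] power2_eq_square intro!: derivative_eq_intros)
  have "b * R\<^sup>2 - b * t0\<^sup>2 \<le> (\<Sum>l\<in>S. ln (R / m l))"
  proof (rule has_integral_le[OF quad int])
    fix t assume t: "t \<in> {t0..R}"
    \<comment> \<open>Since \<open>t \<ge> t0\<close>, the truncation is invisible here: exactly the
      points within distance \<open>t\<close> of \<open>w\<close> contribute
      \<open>1 / t\<close>.\<close>
    have "(\<Sum>l\<in>S. if t \<in> {m l..R} then 1 / t else 0) = (\<Sum>l\<in>S \<inter> cball w t. 1 / t)"
      using t S(1) by (intro sum.mono_neutral_cong_right) (auto simp: m_def dist_norm)
    then have "(\<Sum>l\<in>S. if t \<in> {m l..R} then 1 / t else 0) = real (card (S \<inter> cball w t)) / t"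
      by simp
    moreover have "2 * b * t \<le> real (card (S \<inter> cball w t)) / t"
      using count[of t] t t0 by (simp add: field_simps power2_eq_square)
    ultimately show "2 * b * t \<le> (\<Sum>l\<in>S. if t \<in> {m l..R} then 1 / t else 0)" by simp
  qed
  moreover have "(\<Prod>l\<in>S. cmod (w - l) / R) \<le> exp (- (\<Sum>l\<in>S. ln (R / m l)))"
  proof -
    have "(\<Prod>l\<in>S. cmod (w - l) / R) \<le> (\<Prod>l\<in>S. m l / R)"
      using t0 by (intro prod_mono) (auto simp: m_def divide_right_mono)
    also have "\<dots> = (\<Prod>l\<in>S. exp (- ln (R / m l)))"
    proof (rule prod.cong[OF refl])
      fix l assume "l \<in> S"
      show "m l / R = exp (- ln (R / m l))"
        using m(2)[of l] t0 by (simp add: exp_minus)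
    qed
    also have "\<dots> = exp (- (\<Sum>l\<in>S. ln (R / m l)))"
      using S(1) by (simp add: exp_sum sum_negf[symmetric])
    finally show ?thesis .
  qed
  ultimately show ?thesis
    by (smt (verit) exp_le_cancel_iff right_diff_distrib mult_minus_left)
qed

text \<open>The zeros are divided out one at a time; each quotient extends over its removable
  singularity with the derivative as value.\<close>

lemma entire_factor_zeros:
  fixes f :: "complex \<Rightarrow> complex"
  assumes "finite S" "f holomorphic_on UNIV" "\<And>l. l \<in> S \<Longrightarrow> f l = 0"
  obtains h where "h holomorphic_on UNIV" "\<And>z. f z = h z * (\<Prod>l\<in>S. z - l)"
  using assms
proof (induction S arbitrary: f thesis rule: finite_induct)
  case empty
  then show ?case by (metis mult.right_neutral prod.empty)
next
  case (insert a S)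
  obtain h where h: "h holomorphic_on UNIV" "\<And>z. f z = h z * (\<Prod>l\<in>S. z - l)"
    using insert.IH[OF _ insert.prems(2)] insert.prems(3) by blast
  have "(\<Prod>l\<in>S. a - l) \<noteq> 0" using insert.hyps by auto
  then have ha: "h a = 0" using h(2)[of a] insert.prems(3)[of a] by simp
  define k where "k z = (if z = a then deriv h a else h z / (z - a))" for z
  have "k holomorphic_on UNIV"
    by (rule pole_theorem_open_0[OF h(1), of a]) (auto simp: k_def ha)
  moreover have "f z = k z * (\<Prod>l\<in>insert a S. z - l)" for z
    using insert.hyps h(2) ha by (auto simp: k_def)
  ultimately show ?case using insert.prems(1) by blast
qed

lemma maximum_modulus_cball:
  assumes "f holomorphic_on UNIV" "r \<ge> 0" "\<And>z. z \<in> sphere w r \<Longrightarrow> cmod (f z) \<le> B" "z \<in> cball w r"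
  shows "cmod (f z) \<le> B"
proof (rule maximum_modulus_frontier[of f "cball w r"])
  show "f holomorphic_on interior (cball w r)"
    using assms(1) by (rule holomorphic_on_subset) simp
  show "continuous_on (closure (cball w r)) f"
    using assms(1) by (intro holomorphic_on_imp_continuous_on) (rule holomorphic_on_subset, auto)
qed (use assms in auto)

text \<open>Each factor \<open>z - l\<close> is exchanged for
  \<open>(R\<^sup>2 - cnj (l - w) * (z - w)) / R\<close>, which has the same modulus on the circle
  but equals \<open>R\<close> at the centre. The maximum principle for the new function thus gains
  \<open>cmod (w - l) / R\<close> per zero.\<close>

lemma entire_Blaschke_estimate:
  fixes f :: "complex \<Rightarrow> complex"
  assumes S: "finite S" "S \<subseteq> cball w R" and R: "R > 0"
    and f: "f holomorphic_on UNIV" "\<And>l. l \<in> S \<Longrightarrow> f l = 0"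
    and M: "\<And>z. z \<in> sphere w R \<Longrightarrow> cmod (f z) \<le> M"
  shows "cmod (f w) \<le> (\<Prod>l\<in>S. cmod (w - l) / R) * M"
proof -
  obtain h where h: "h holomorphic_on UNIV" "\<And>z. f z = h z * (\<Prod>l\<in>S. z - l)"
    using entire_factor_zeros[OF S(1) f] by blast
  define g where "g z = h z * (\<Prod>l\<in>S. (of_real (R\<^sup>2) - cnj (l - w) * (z - w)) / of_real R)" for z
  have "g holomorphic_on UNIV"
    unfolding g_def using R by (intro holomorphic_intros h) auto
  moreover have "cmod (g z) \<le> M" if z: "z \<in> sphere w R" for z
  proof -
    have zR: "cmod (z - w) = R" using z by (simp add: dist_norm norm_minus_commute)
    have "cmod ((of_real (R\<^sup>2) - cnj (l - w) * (z - w)) / of_real R) = cmod (z - l)" for l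
    proof -
      have "of_real (R\<^sup>2) = (z - w) * cnj (z - w)"
        using zR complex_norm_square[of "z - w"] by simp
      then have "of_real (R\<^sup>2) - cnj (l - w) * (z - w) = (z - w) * cnj (z - l)"
        by (simp add: algebra_simps)
      then show ?thesis using zR R by (simp only: norm_mult norm_divide complex_mod_cnj norm_of_real) simp
    qed
    then have "(\<Prod>l\<in>S. cmod ((of_real (R\<^sup>2) - cnj (l - w) * (z - w)) / of_real R)) = (\<Prod>l\<in>S. cmod (z - l))"
      by (intro prod.cong refl)
    then have "cmod (g z) = cmod (f z)"
      unfolding g_def h(2) norm_mult prod_norm by (rule arg_cong)
    then show ?thesis using M[OF z] by simp
  qed
  ultimately have "cmod (g w) \<le> M"
    using R by (intro maximum_modulus_cball[of g R w M w]) auto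
  moreover have "cmod (f w) = (\<Prod>l\<in>S. cmod (w - l) / R) * cmod (g w)"
  proof -
    have "g w = h w * of_real R ^ card S"
      using R by (simp add: g_def power2_eq_square)
    then have "cmod (g w) = cmod (h w) * R ^ card S"
      using R by (simp add: norm_mult norm_power)
    moreover have "cmod (f w) = cmod (h w) * (\<Prod>l\<in>S. cmod (w - l))"
      unfolding h(2) norm_mult prod_norm ..
    ultimately show ?thesis using R by (simp add: prod_dividef)
  qed
  moreover have "(\<Prod>l\<in>S. cmod (w - l) / R) \<ge> 0" using R by (intro prod_nonneg) auto
  ultimately show ?thesis by (simp only: mult_left_mono)
qed

text \<open>On the disc each factor of a basis polynomial has modulus at most
  \<open>2 * R / \<delta>\<close>; the maximum with 1 allows the exponent to be raised to
  \<open>k\<close>. The bound does not involve the centre \<open>w\<close>, which is what makes the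
  sampling constants uniform.\<close>

lemma Lagrange_interpolation_bound:
  fixes v :: "complex \<Rightarrow> complex"
  assumes S: "finite S" "S \<subseteq> cball w R" and card: "card S \<le> k"
    and \<delta>: "\<delta> > 0" "\<And>x y. \<lbrakk>x \<in> S; y \<in> S; x \<noteq> y\<rbrakk> \<Longrightarrow> \<delta> \<le> dist x y"
    and \<mu>: "\<mu> \<ge> 0" "\<And>l. l \<in> S \<Longrightarrow> cmod (v l) \<le> \<mu>"
  obtains L where "L holomorphic_on UNIV" "\<And>l. l \<in> S \<Longrightarrow> L l = v l"
    "\<And>z. z \<in> cball w R \<Longrightarrow> cmod (L z) \<le> real k * (max 1 (2 * R / \<delta>)) ^ k * \<mu>"
proof
  define L where "L z = (\<Sum>j\<in>S. v j * (\<Prod>i\<in>S - {j}. (z - i) / (j - i)))" for z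
  show "L holomorphic_on UNIV" unfolding L_def by (intro holomorphic_intros) auto
  show "L l = v l" if "l \<in> S" for l
  proof -
    have "(\<Prod>i\<in>S - {j}. (l - i) / (j - i)) = (if j = l then 1 else 0)" for j
    proof (cases "j = l")
      case True
      have "(l - i) / (l - i) = 1" if "i \<in> S - {l}" for i using that by auto
      then show ?thesis using True by (simp add: prod.neutral)
    next
      case False
      then show ?thesis using that S(1) by (auto simp: prod_zero_iff)
    qed
    then show ?thesis using that S(1) by (simp add: L_def if_distrib[of "\<lambda>x. v _ * x"] cong: if_cong)
  qed
  show "cmod (L z) \<le> real k * (max 1 (2 * R / \<delta>)) ^ k * \<mu>" if z: "z \<in> cball w R" for z
  proof -
    define Q where "Q = max 1 (2 * R / \<delta>)"
    have Q: "Q \<ge> 1" "2 * R / \<delta> \<le> Q" by (auto simp: Q_def)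
    have summand: "cmod (v j * (\<Prod>i\<in>S - {j}. (z - i) / (j - i))) \<le> \<mu> * Q ^ k" if j: "j \<in> S" for j
    proof -
      have "cmod (\<Prod>i\<in>S - {j}. (z - i) / (j - i)) \<le> (\<Prod>i\<in>S - {j}. Q)"
        unfolding prod_norm[symmetric]
      proof (rule prod_mono, rule conjI)
        fix i assume i: "i \<in> S - {j}"
        have zi: "dist z i \<le> 2 * R" using z S(2) i dist_triangle2[of z i w] by (force simp: dist_commute)
        then have "cmod (z - i) \<le> 2 * R" by (simp add: dist_norm)
        moreover have "\<delta> \<le> cmod (j - i)" using \<delta>(2)[of j i] i j by (auto simp: dist_norm)
        moreover have "0 \<le> R" using zi zero_le_dist[of z i] by linarith
        ultimately have "cmod ((z - i) / (j - i)) \<le> 2 * R / \<delta>"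
          using \<delta>(1) unfolding norm_divide dist_norm by (intro frac_le) auto
        then show "cmod ((z - i) / (j - i)) \<le> Q" using Q by linarith
      qed simp
      also have "\<dots> \<le> Q ^ k"
        using Q(1) card S(1) by (auto intro!: power_increasing intro: order.trans[OF card_Diff1_le])
      finally show ?thesis
        unfolding norm_mult using \<mu>(1) \<mu>(2)[OF j] by (intro mult_mono) auto
    qed
    have "cmod (L z) \<le> (\<Sum>j\<in>S. \<mu> * Q ^ k)" unfolding L_def using summand by (rule sum_norm_le)
    also have "\<dots> \<le> real k * (\<mu> * Q ^ k)"
      using card \<mu>(1) Q(1) by (simp add: mult_right_mono)
    finally show ?thesis by (simp add: Q_def mult_ac)
  qed
qed

text \<open>The Blaschke estimate applies to \<open>f\<close> minus its interpolant. The factor 2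
  arises because the interpolant enters once at \<open>w\<close> and once on the circle, where it is
  multiplied by a product of value at most 1.\<close>

lemma local_sampling_estimate:
  fixes f :: "complex \<Rightarrow> complex"
  assumes S: "finite S" "S \<subseteq> cball w R" and R: "R > 0" and card: "card S \<le> k"
    and \<delta>: "\<delta> > 0" "\<And>x y. \<lbrakk>x \<in> S; y \<in> S; x \<noteq> y\<rbrakk> \<Longrightarrow> \<delta> \<le> dist x y"
    and f: "f holomorphic_on UNIV"
    and \<mu>: "\<mu> \<ge> 0" "\<And>l. l \<in> S \<Longrightarrow> cmod (f l) \<le> \<mu>"
    and M: "\<And>z. z \<in> sphere w R \<Longrightarrow> cmod (f z) \<le> M"
  shows "cmod (f w) \<le> (\<Prod>l\<in>S. cmod (w - l) / R) * M + 2 * (real k * (max 1 (2 * R / \<delta>)) ^ k * \<mu>)"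
proof -
  define E where "E = (\<Prod>l\<in>S. cmod (w - l) / R)"
  define B where "B = real k * (max 1 (2 * R / \<delta>)) ^ k * \<mu>"
  obtain L where L: "L holomorphic_on UNIV" "\<And>l. l \<in> S \<Longrightarrow> L l = f l"
    "\<And>z. z \<in> cball w R \<Longrightarrow> cmod (L z) \<le> B"
    unfolding B_def by (rule Lagrange_interpolation_bound[of S w R k \<delta> \<mu> f]) (use S card \<delta> \<mu> in auto)
  have E: "E \<le> 1"
    unfolding E_def using S(2) R by (intro prod_le_1) (auto simp: dist_norm)
  have "B \<ge> 0" using \<mu>(1) by (simp add: B_def)
  have "cmod (f w - L w) \<le> E * (M + B)"
    unfolding E_def
  proof (rule entire_Blaschke_estimate[OF S R])
    show "(\<lambda>z. f z - L z) holomorphic_on UNIV" by (intro holomorphic_intros f L)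
    show "f l - L l = 0" if "l \<in> S" for l using L(2)[OF that] by simp
    show "cmod (f z - L z) \<le> M + B" if "z \<in> sphere w R" for z
      using norm_triangle_ineq4[of "f z" "L z"] M[OF that] L(3)[of z] that by auto
  qed
  moreover have "cmod (L w) \<le> B" using L(3) R by simp
  moreover have "cmod (f w) \<le> cmod (f w - L w) + cmod (L w)"
    by (metis diff_add_cancel norm_triangle_ineq)
  moreover have "E * B \<le> B" using mult_right_mono[OF E \<open>B \<ge> 0\<close>] by simp
  ultimately show ?thesis unfolding E_def[symmetric] B_def[symmetric] by (simp add: algebra_simps)
qed

section \<open>Gaussian weights and the global sampling inequality\<close>

text \<open>The twist by \<open>exp (- 2 \<beta> (w - v)\<^sup>* (z - w))\<close> moves the centre of the Gaussian weight
  from \<open>v\<close> to \<open>w\<close>, so the local estimate at \<open>w\<close> holds with constants independent of \<open>w\<close> and \<open>v\<close>.\<close>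

lemma Gaussian_shift:
  fixes v w z :: complex
  shows "cmod (exp (- of_real (2 * \<beta>) * cnj (w - v) * (z - w)))
     = exp (\<beta> * (cmod (w - v))\<^sup>2 + \<beta> * (cmod (z - w))\<^sup>2 - \<beta> * (cmod (z - v))\<^sup>2)"
  unfolding norm_exp_eq_Re cmod_power2 by (simp add: algebra_simps power2_eq_square)

text \<open>After the weight is recentred at \<open>w\<close>, it costs a factor
  \<open>exp (\<beta> * R\<^sup>2)\<close> on the disc. The Blaschke decay
  \<open>exp (- b * (R\<^sup>2 - t0\<^sup>2))\<close> beats this for large \<open>R\<close> because
  \<open>\<beta> < b\<close>, which yields the factor 1/2. \<open>R\<close> and \<open>C\<close> are
  fixed before \<open>f\<close>, \<open>v\<close>, \<open>w\<close>, \<open>A\<close> and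
  \<open>\<mu>\<close>.\<close>

lemma weighted_local_estimate:
  fixes L :: "complex set"
  assumes L: "uniform_discrete L" and b: "0 < \<beta>" "\<beta> < b" and t0: "t0 > 0"
    and count: "\<And>w t. t0 \<le> t \<Longrightarrow> 2 * b * t\<^sup>2 \<le> real (card (L \<inter> cball w t))"
  obtains R C where "R > 0" "C \<ge> 0"
    "\<And>f v w A \<mu>. f holomorphic_on UNIV \<Longrightarrow>
       (\<And>z. z \<in> cball w R \<Longrightarrow> cmod (f z) \<le> A * exp (\<beta> * (cmod (z - v))\<^sup>2)) \<Longrightarrow>
       (\<And>z. z \<in> L \<Longrightarrow> cmod (f z) \<le> \<mu> * exp (\<beta> * (cmod (z - v))\<^sup>2)) \<Longrightarrow> \<mu> \<ge> 0 \<Longrightarrow>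
       cmod (f w) \<le> (A / 2 + C * \<mu>) * exp (\<beta> * (cmod (w - v))\<^sup>2)"
proof -
  have "((\<lambda>R. exp (- b * (R\<^sup>2 - t0\<^sup>2)) * exp (\<beta> * R\<^sup>2)) \<longlongrightarrow> 0) at_top"
    using b by real_asymp
  then have "\<forall>\<^sub>F R in at_top. exp (- b * (R\<^sup>2 - t0\<^sup>2)) * exp (\<beta> * R\<^sup>2) < 1 / 2"
    by (rule order_tendstoD) simp
  then have "\<forall>\<^sub>F R in at_top. exp (- b * (R\<^sup>2 - t0\<^sup>2)) * exp (\<beta> * R\<^sup>2) < 1 / 2 \<and> R \<ge> t0"
    using eventually_ge_at_top[of t0] by (rule eventually_conj)
  then obtain R where R: "exp (- b * (R\<^sup>2 - t0\<^sup>2)) * exp (\<beta> * R\<^sup>2) < 1 / 2" "R \<ge> t0"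
    using eventually_happens by fastforce
  obtain \<delta> where \<delta>: "\<delta> > 0" "\<And>x y. \<lbrakk>x \<in> L; y \<in> L; x \<noteq> y\<rbrakk> \<Longrightarrow> \<delta> \<le> dist x y"
    using L unfolding uniform_discrete_def by (meson not_less)
  obtain k where k: "\<And>w. card (L \<inter> cball w R) \<le> k"
    using uniform_discrete_card_cball_bounded[OF L] by blast
  define C where "C = 2 * (real k * (max 1 (2 * R / \<delta>)) ^ k * exp (\<beta> * R\<^sup>2))"
  have main: "cmod (f w) \<le> (A / 2 + C * \<mu>) * exp (\<beta> * (cmod (w - v))\<^sup>2)"
    if f: "f holomorphic_on UNIV"
      and A: "\<And>z. z \<in> cball w R \<Longrightarrow> cmod (f z) \<le> A * exp (\<beta> * (cmod (z - v))\<^sup>2)"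
      and \<mu>: "\<And>z. z \<in> L \<Longrightarrow> cmod (f z) \<le> \<mu> * exp (\<beta> * (cmod (z - v))\<^sup>2)" "\<mu> \<ge> 0"
    for f v w A \<mu>
  proof -
    define S where "S = L \<inter> cball w R"
    define G where "G = exp (\<beta> * (cmod (w - v))\<^sup>2)"
    define F where "F z = f z * exp (- of_real (2 * \<beta>) * cnj (w - v) * (z - w))" for z
    have Fbound: "cmod (F z) \<le> a * exp (\<beta> * R\<^sup>2) * G"
      if "z \<in> cball w R" "cmod (f z) \<le> a * exp (\<beta> * (cmod (z - v))\<^sup>2)" "a \<ge> 0" for a z
    proof -
      have "cmod (F z) = cmod (f z) * exp (\<beta> * (cmod (w - v))\<^sup>2 + \<beta> * (cmod (z - w))\<^sup>2 - \<beta> * (cmod (z - v))\<^sup>2)"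
        unfolding F_def norm_mult Gaussian_shift ..
      also have "\<dots> \<le> a * exp (\<beta> * (cmod (z - v))\<^sup>2) * exp (\<beta> * (cmod (w - v))\<^sup>2 + \<beta> * (cmod (z - w))\<^sup>2 - \<beta> * (cmod (z - v))\<^sup>2)"
        using that(2) by (intro mult_right_mono) auto
      also have "\<dots> = a * G * exp (\<beta> * (cmod (z - w))\<^sup>2)"
        by (simp add: G_def exp_add exp_diff)
      also have "\<dots> \<le> a * G * exp (\<beta> * R\<^sup>2)"
        using that(1,3) b(1) by (intro mult_left_mono)
          (auto simp: G_def dist_norm norm_minus_commute intro!: power_mono)
      finally show ?thesis by (simp add: mult_ac)
    qed
    \<comment> \<open>The sign of \<open>A\<close> comes from the bound at the centre
      \<open>w\<close>, which dominates a modulus.\<close>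
    have "0 \<le> A * exp (\<beta> * (cmod (w - v))\<^sup>2)"
      using A[of w] norm_ge_zero[of "f w"] R(2) t0 by (intro order.trans[OF norm_ge_zero]) auto
    then have "A \<ge> 0" by (simp add: zero_le_mult_iff)
    have "G > 0" by (simp add: G_def)
    define E where "E = (\<Prod>l\<in>S. cmod (w - l) / R)"
    have finS: "finite S" unfolding S_def using L by (rule uniform_discrete_finite_cball)
    have "cmod (F w) \<le> E * (A * exp (\<beta> * R\<^sup>2) * G)
        + 2 * (real k * (max 1 (2 * R / \<delta>)) ^ k * (\<mu> * exp (\<beta> * R\<^sup>2) * G))"
      unfolding E_def
    proof (rule local_sampling_estimate[of S w R k \<delta> F])
      show "F holomorphic_on UNIV" unfolding F_def by (intro holomorphic_intros f)
      show "cmod (F l) \<le> \<mu> * exp (\<beta> * R\<^sup>2) * G" if "l \<in> S" for l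
        using that \<mu> by (intro Fbound) (auto simp: S_def)
      show "cmod (F z) \<le> A * exp (\<beta> * R\<^sup>2) * G" if "z \<in> sphere w R" for z
        using that A \<open>A \<ge> 0\<close> by (intro Fbound) auto
    qed (use finS k \<delta> R t0 \<mu>(2) \<open>G > 0\<close> in \<open>auto simp: S_def\<close>)
    also have "\<dots> = (E * exp (\<beta> * R\<^sup>2) * A + C * \<mu>) * G" by (simp add: C_def algebra_simps)
    also have "\<dots> \<le> (A / 2 + C * \<mu>) * G"
    proof (rule mult_right_mono)
      have "E \<le> exp (- b * (R\<^sup>2 - t0\<^sup>2))" unfolding E_def
      proof (rule prod_norm_le_exp[OF finS])
        fix t assume "t0 \<le> t" "t \<le> R"
        then have "S \<inter> cball w t = L \<inter> cball w t" by (auto simp: S_def)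
        then show "2 * b * t\<^sup>2 \<le> real (card (S \<inter> cball w t))" using count[OF \<open>t0 \<le> t\<close>] by simp
      qed (use t0 R in \<open>auto simp: S_def\<close>)
      then have "E * exp (\<beta> * R\<^sup>2) \<le> exp (- b * (R\<^sup>2 - t0\<^sup>2)) * exp (\<beta> * R\<^sup>2)"
        by (rule mult_right_mono) simp
      then have "E * exp (\<beta> * R\<^sup>2) \<le> 1 / 2" using R(1) by linarith
      from mult_right_mono[OF this \<open>A \<ge> 0\<close>]
      show "E * exp (\<beta> * R\<^sup>2) * A + C * \<mu> \<le> A / 2 + C * \<mu>" by simp
    qed (use \<open>G > 0\<close> in simp)
    finally show ?thesis by (simp add: F_def G_def)
  qed
  show ?thesis
  proof (rule that[of R C])
    show "R > 0" using R t0 by simp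
    show "C \<ge> 0" using R t0 by (simp add: C_def)
  qed (rule main)
qed

text \<open>For each \<open>v\<close> one sufficiently large radius with the growth bound is enough,
  and \<open>C\<close> stems from the local estimate alone, so it does not depend on that
  radius.\<close>

lemma sampling_inequality:
  fixes L :: "complex set"
  assumes L: "uniform_discrete L" and b: "0 < \<beta>" "\<beta>0 < \<beta>" "\<beta> < b" and t0: "t0 > 0"
    and count: "\<And>w t. t0 \<le> t \<Longrightarrow> 2 * b * t\<^sup>2 \<le> real (card (L \<inter> cball w t))"
    and f: "f holomorphic_on UNIV"
    and growth: "\<exists>\<^sub>F r in at_top. \<forall>z\<in>cball 0 r. cmod (f z) \<le> exp (\<beta>0 * r\<^sup>2)"
  obtains C where "C \<ge> 0"
    "\<And>v \<mu>. \<mu> \<ge> 0 \<Longrightarrow> (\<And>z. z \<in> L \<Longrightarrow> cmod (f z) \<le> \<mu> * exp (\<beta> * (cmod (z - v))\<^sup>2)) \<Longrightarrow> cmod (f v) \<le> C * \<mu>"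
proof -
  obtain R C where R: "R > 0" and C: "C \<ge> 0" and loc:
    "\<And>v w A \<mu>. (\<And>z. z \<in> cball w R \<Longrightarrow> cmod (f z) \<le> A * exp (\<beta> * (cmod (z - v))\<^sup>2)) \<Longrightarrow>
       (\<And>z. z \<in> L \<Longrightarrow> cmod (f z) \<le> \<mu> * exp (\<beta> * (cmod (z - v))\<^sup>2)) \<Longrightarrow> \<mu> \<ge> 0 \<Longrightarrow>
       cmod (f w) \<le> (A / 2 + C * \<mu>) * exp (\<beta> * (cmod (w - v))\<^sup>2)"
    by (rule weighted_local_estimate[OF L b(1,3) t0 count]) (use f in blast)+
  \<comment> \<open>The factor 2 results from solving
    \<open>\<phi> w \<le> \<phi> w / 2 + C * \<mu>\<close> for the maximum \<open>\<phi> w\<close>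
    of the weighted modulus.\<close>
  have "cmod (f v) \<le> 2 * C * \<mu>"
    if \<mu>: "\<mu> \<ge> 0" and fL: "\<And>z. z \<in> L \<Longrightarrow> cmod (f z) \<le> \<mu> * exp (\<beta> * (cmod (z - v))\<^sup>2)" for v \<mu>
  proof (rule ccontr)
    assume contra: "\<not> ?thesis"
    have "0 \<le> 2 * C * \<mu>" using C \<mu> by simp
    then have fv: "cmod (f v) > 0" using contra by linarith
    \<comment> \<open>This quantity bounds the weighted modulus in the strip of width
      \<open>R\<close> along the boundary of the disc of radius \<open>r\<close>; it decays because
      \<open>\<beta>0 < \<beta>\<close>.\<close>
    have "((\<lambda>r. exp (\<beta>0 * r\<^sup>2 - \<beta> * (r - R - cmod v)\<^sup>2)) \<longlongrightarrow> 0) at_top"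
      using b by real_asymp
    then have "\<forall>\<^sub>F r in at_top. exp (\<beta>0 * r\<^sup>2 - \<beta> * (r - R - cmod v)\<^sup>2) < cmod (f v)"
      using fv by (rule order_tendstoD)
    moreover have "\<forall>\<^sub>F r in at_top. r \<ge> R + cmod v" by (rule eventually_ge_at_top)
    ultimately have "\<forall>\<^sub>F r in at_top. exp (\<beta>0 * r\<^sup>2 - \<beta> * (r - R - cmod v)\<^sup>2) < cmod (f v) \<and> r \<ge> R + cmod v"
      by (rule eventually_conj)
    from frequently_ex[OF frequently_eventually_frequently[OF growth this]]
    obtain r where r: "\<And>z. z \<in> cball 0 r \<Longrightarrow> cmod (f z) \<le> exp (\<beta>0 * r\<^sup>2)"
      "exp (\<beta>0 * r\<^sup>2 - \<beta> * (r - R - cmod v)\<^sup>2) < cmod (f v)" "r \<ge> R + cmod v"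
      by blast
    define \<phi> where "\<phi> z = cmod (f z) * exp (- \<beta> * (cmod (z - v))\<^sup>2)" for z
    have "continuous_on (cball 0 r) \<phi>" unfolding \<phi>_def
      by (intro continuous_intros holomorphic_on_imp_continuous_on holomorphic_on_subset[OF f]) auto
    moreover have v: "v \<in> cball 0 r" using r(3) R by simp
    ultimately obtain w where w: "w \<in> cball 0 r" "\<And>z. z \<in> cball 0 r \<Longrightarrow> \<phi> z \<le> \<phi> w"
      using continuous_attains_sup[of "cball 0 r" \<phi>] by (metis compact_cball empty_iff)
    have fw: "cmod (f v) \<le> \<phi> w" using w(2)[OF v] by (simp add: \<phi>_def)
    have f\<phi>: "cmod (f z) = \<phi> z * exp (\<beta> * (cmod (z - v))\<^sup>2)" for z
      by (simp add: \<phi>_def exp_minus)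
    \<comment> \<open>Either the disc of radius \<open>R\<close> about the maximum point
      \<open>w\<close> fits into the large disc and the local estimate applies with
      \<open>A = \<phi> w\<close>, or \<open>w\<close> lies in the boundary strip, where the growth
      bound pushes \<open>\<phi> w\<close> below \<open>cmod (f v)\<close>.\<close>
    show False
    proof (cases "cmod w \<le> r - R")
      case True
      have "cmod (f w) \<le> (\<phi> w / 2 + C * \<mu>) * exp (\<beta> * (cmod (w - v))\<^sup>2)"
      proof (rule loc[OF _ fL \<mu>])
        fix z assume "z \<in> cball w R"
        then have "z \<in> cball 0 r"
          using True norm_triangle_sub[of z w] by (auto simp: dist_norm norm_minus_commute)
        then show "cmod (f z) \<le> \<phi> w * exp (\<beta> * (cmod (z - v))\<^sup>2)"
          unfolding f\<phi> by (intro mult_right_mono w(2)) auto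
      qed
      then have "\<phi> w \<le> \<phi> w / 2 + C * \<mu>" unfolding f\<phi> by simp
      then show False using fw contra by simp
    next
      case False
      have "cmod (w - v) \<ge> r - R - cmod v"
        using False norm_triangle_sub[of w v] by simp
      then have "(r - R - cmod v)\<^sup>2 \<le> (cmod (w - v))\<^sup>2"
        using r(3) by (intro power_mono) auto
      then have "exp (- \<beta> * (cmod (w - v))\<^sup>2) \<le> exp (- \<beta> * (r - R - cmod v)\<^sup>2)"
        using b(1) by simp
      then have "\<phi> w \<le> exp (\<beta>0 * r\<^sup>2) * exp (- \<beta> * (r - R - cmod v)\<^sup>2)"
        unfolding \<phi>_def using r(1)[OF w(1)] by (intro mult_mono) auto
      also have "\<dots> = exp (\<beta>0 * r\<^sup>2 - \<beta> * (r - R - cmod v)\<^sup>2)" by (simp add: exp_add[symmetric])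
      finally show False using r(2) fw by linarith
    qed
  qed
  then show ?thesis using C by (intro that[of "2 * C"]) auto
qed

section \<open>Polynomial growth and Liouville's theorem\<close>

lemma poly_norm_bound:
  fixes g :: "complex poly"
  obtains B where "B \<ge> 0" "\<And>z. cmod (poly g z) \<le> B * (1 + cmod z) ^ degree g"
proof
  show "(\<Sum>i\<le>degree g. cmod (coeff g i)) \<ge> 0" by (intro sum_nonneg) auto
  show "cmod (poly g z) \<le> (\<Sum>i\<le>degree g. cmod (coeff g i)) * (1 + cmod z) ^ degree g" for z
    unfolding poly_altdef sum_distrib_right
  proof (rule sum_norm_le)
    fix i assume "i \<in> {..degree g}"
    have "cmod z ^ i \<le> (1 + cmod z) ^ i" by (intro power_mono) auto
    also have "\<dots> \<le> (1 + cmod z) ^ degree g" using \<open>i \<in> _\<close> by (intro power_increasing) auto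
    finally show "cmod (coeff g i * z ^ i) \<le> cmod (coeff g i) * (1 + cmod z) ^ degree g"
      by (simp add: norm_mult norm_power mult_left_mono)
  qed
qed

lemma power_le_Gaussian:
  fixes \<beta> :: real
  assumes "\<beta> > 0"
  obtains B where "\<And>s. s \<ge> 0 \<Longrightarrow> (1 + s) ^ q \<le> B * exp (\<beta> * s\<^sup>2)"
proof -
  define h where "h s = (1 + s) ^ q * exp (- \<beta> * s\<^sup>2)" for s :: real
  have "(h \<longlongrightarrow> 0) at_top" unfolding h_def using assms by real_asymp
  then have "\<forall>\<^sub>F s in at_top. h s < 1" by (rule order_tendstoD) simp
  then obtain N where N: "\<And>s. s \<ge> N \<Longrightarrow> h s < 1"
    unfolding eventually_at_top_linorder by blast
  have "compact (h ` {0..N})"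
    unfolding h_def by (intro compact_continuous_image continuous_intros compact_Icc)
  then obtain B where B: "\<And>s. s \<in> {0..N} \<Longrightarrow> h s \<le> B"
    using compact_imp_bounded[of "h ` {0..N}"] unfolding bounded_real by (metis abs_le_D1 imageI)
  have "(1 + s) ^ q \<le> max 1 B * exp (\<beta> * s\<^sup>2)" if "s \<ge> 0" for s
  proof -
    have "h s \<le> max 1 B" using N[of s] B[of s] that by (cases "s \<le> N") auto
    then show ?thesis by (simp add: h_def exp_minus field_simps)
  qed
  then show ?thesis using that by blast
qed

lemma entire_polynomial_growth:
  assumes f: "f holomorphic_on UNIV" and bound: "\<And>z. cmod (f z) \<le> B * (1 + cmod z) ^ q"
  obtains p :: "complex poly" where "f = poly p" "degree p \<le> q"
proof
  define p where "p = (\<Sum>k\<le>q. monom ((deriv ^^ k) f 0 / fact k) k)"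
  have "B \<ge> 0" using order.trans[OF norm_ge_zero bound[of 0]] by simp
  have "cmod (f z) \<le> (B * 2 ^ q) * cmod z ^ q" if "1 \<le> cmod z" for z
  proof -
    have "(1 + cmod z) ^ q \<le> (2 * cmod z) ^ q" using that by (intro power_mono) auto
    then show ?thesis using bound[of z] mult_left_mono[OF _ \<open>B \<ge> 0\<close>]
      by (fastforce simp: power_mult_distrib mult_ac)
  qed
  from Liouville_polynomial[OF f this] show "f = poly p"
    by (auto simp: p_def poly_sum poly_monom)
  show "degree p \<le> q"
    unfolding p_def by (intro degree_sum_le) (auto intro: order.trans[OF degree_monom_le])
qed

text \<open>The sampling inequality is used with a \<open>\<mu>\<close> that depends on
  \<open>v\<close>. The inequality \<open>1 + cmod z \<le> (1 + cmod v) * (1 + cmod (z - v))\<close>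
  separates the growth in \<open>v\<close> from that in \<open>z - v\<close>, and the Gaussian
  absorbs the latter.\<close>

lemma dominated_on_sampling_set_imp_polynomial:
  fixes L :: "complex set" and g :: "complex poly"
  assumes L: "uniform_discrete L" and b: "0 < \<beta>" "\<beta>0 < \<beta>" "\<beta> < b" and t0: "t0 > 0"
    and count: "\<And>w t. t0 \<le> t \<Longrightarrow> 2 * b * t\<^sup>2 \<le> real (card (L \<inter> cball w t))"
    and f: "f holomorphic_on UNIV"
    and growth: "\<exists>\<^sub>F r in at_top. \<forall>z\<in>cball 0 r. cmod (f z) \<le> exp (\<beta>0 * r\<^sup>2)"
    and c: "c > 0" "\<And>z. z \<in> L \<Longrightarrow> cmod (f z) \<le> c * cmod (poly g z)"
  obtains p :: "complex poly" where "f = poly p" "degree p \<le> degree g"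
proof -
  obtain C where C: "C \<ge> 0" and samp:
    "\<And>v \<mu>. \<mu> \<ge> 0 \<Longrightarrow> (\<And>z. z \<in> L \<Longrightarrow> cmod (f z) \<le> \<mu> * exp (\<beta> * (cmod (z - v))\<^sup>2)) \<Longrightarrow> cmod (f v) \<le> C * \<mu>"
    using sampling_inequality[OF L b t0 count f growth] by blast
  obtain B where B: "B \<ge> 0" "\<And>z. cmod (poly g z) \<le> B * (1 + cmod z) ^ degree g"
    using poly_norm_bound by blast
  obtain D where D: "\<And>s. s \<ge> 0 \<Longrightarrow> (1 + s) ^ degree g \<le> D * exp (\<beta> * s\<^sup>2)"
    using power_le_Gaussian[OF b(1)] by blast
  have "D \<ge> 0" using D[of 0] by simp
  have "cmod (f v) \<le> C * c * B * D * (1 + cmod v) ^ degree g" for v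
  proof -
    have "cmod (f v) \<le> C * (c * B * D * (1 + cmod v) ^ degree g)"
    proof (rule samp)
      show "c * B * D * (1 + cmod v) ^ degree g \<ge> 0" using c(1) B(1) \<open>D \<ge> 0\<close> by simp
      fix z assume z: "z \<in> L"
      have "1 + cmod z \<le> (1 + cmod v) * (1 + cmod (z - v))"
        using norm_triangle_sub[of z v] mult_nonneg_nonneg[OF norm_ge_zero[of v] norm_ge_zero[of "z - v"]]
        unfolding distrib_left distrib_right by linarith
      then have "(1 + cmod z) ^ degree g \<le> ((1 + cmod v) * (1 + cmod (z - v))) ^ degree g"
        by (intro power_mono) auto
      also have "\<dots> \<le> (1 + cmod v) ^ degree g * (D * exp (\<beta> * (cmod (z - v))\<^sup>2))"
        unfolding power_mult_distrib by (intro mult_left_mono D) auto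
      finally have *: "(1 + cmod z) ^ degree g \<le> (1 + cmod v) ^ degree g * (D * exp (\<beta> * (cmod (z - v))\<^sup>2))" .
      have "cmod (f z) \<le> c * (B * (1 + cmod z) ^ degree g)"
        using c(2)[OF z] mult_left_mono[OF B(2)[of z], of c] c(1) by linarith
      also have "\<dots> \<le> c * (B * ((1 + cmod v) ^ degree g * (D * exp (\<beta> * (cmod (z - v))\<^sup>2))))"
        using * c(1) B(1) by (intro mult_left_mono) auto
      finally show "cmod (f z) \<le> c * B * D * (1 + cmod v) ^ degree g * exp (\<beta> * (cmod (z - v))\<^sup>2)"
        by (simp add: mult_ac)
    qed
    then show ?thesis by (simp add: mult_ac)
  qed
  then show ?thesis using entire_polynomial_growth[OF f] that by blast
qed

section \<open>Moduli of polynomials on relatively dense sets\<close>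

text \<open>Points of \<open>L\<close> near \<open>n * w\<close>, divided by \<open>n\<close>, converge to \<open>w\<close>, and division of the sum by
  \<open>n ^ d\<close> isolates the top component.\<close>

lemma top_homogeneous_component_zero:
  fixes Q :: "nat \<Rightarrow> complex \<Rightarrow> complex" and L :: "complex set"
  assumes dense: "\<And>w. \<exists>z\<in>L. dist w z \<le> R"
    and hom: "\<And>m s z. Q m (of_real s * z) = of_real s ^ m * Q m z"
    and cont: "\<And>m. continuous_on UNIV (Q m)"
    and zero: "\<And>z. z \<in> L \<Longrightarrow> (\<Sum>m\<le>d. Q m z) = 0"
  shows "Q d w = 0"
proof -
  obtain l where l: "\<And>n::nat. l n \<in> L" "\<And>n. dist (of_nat n * w) (l n) \<le> R"
  proof -
    have "\<exists>l. \<forall>n::nat. l n \<in> L \<and> dist (of_nat n * w) (l n) \<le> R"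
      using dense by (intro choice) blast
    then show ?thesis using that by blast
  qed
  \<comment> \<open>At \<open>n = 0\<close> the division gives 0; only limits and eventual
    statements about \<open>u\<close> follow.\<close>
  define u where "u n = of_real (1 / real n) * l n" for n
  have "(\<lambda>n. u n - w) \<longlonglongrightarrow> 0"
  proof (rule Lim_null_comparison)
    show "\<forall>\<^sub>F n in sequentially. norm (u n - w) \<le> R * (1 / real n)"
      using eventually_gt_at_top[of 0]
    proof eventually_elim
      case (elim n)
      have "u n - w = of_real (1 / real n) * (l n - of_nat n * w)"
        using elim by (simp add: u_def field_simps)
      then have "norm (u n - w) = 1 / real n * dist (of_nat n * w) (l n)"
        by (simp add: norm_mult norm_divide dist_norm norm_minus_commute)
      then show ?case using mult_left_mono[OF l(2)[of n], of "1 / real n"] by (simp add: mult.commute)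
    qed
    show "(\<lambda>n. R * (1 / real n)) \<longlonglongrightarrow> 0"
      by (rule tendsto_mult_right_zero[OF lim_1_over_n])
  qed
  then have u: "u \<longlonglongrightarrow> w" by (simp add: LIM_zero_iff)
  have Qu: "(\<lambda>n. Q m (u n)) \<longlonglongrightarrow> Q m w" for m
    using cont[of m] u by (intro isCont_tendsto_compose[of w "Q m"]) (simp_all add: continuous_on_eq_continuous_at)
  have coef: "(\<lambda>n. of_real (1 / real n) ^ (d - m)) \<longlonglongrightarrow> (if m = d then 1 else 0 :: complex)" if "m \<le> d" for m
  proof -
    have "(\<lambda>n. complex_of_real (1 / real n) ^ (d - m)) \<longlonglongrightarrow> of_real 0 ^ (d - m)"
      by (intro tendsto_power tendsto_of_real lim_1_over_n)
    then show ?thesis using that by (auto simp: power_0_left)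
  qed
  have "(\<lambda>n. \<Sum>m\<le>d. of_real (1 / real n) ^ (d - m) * Q m (u n)) \<longlonglongrightarrow> (\<Sum>m\<le>d. (if m = d then 1 else 0) * Q m w)"
    by (intro tendsto_sum tendsto_mult Qu coef) auto
  moreover have "\<forall>\<^sub>F n in sequentially. (\<Sum>m\<le>d. of_real (1 / real n) ^ (d - m) * Q m (u n)) = 0"
    using eventually_gt_at_top[of 0]
  proof eventually_elim
    case (elim n)
    \<comment> \<open>Homogeneity contributes the power \<open>m\<close> of \<open>1 / n\<close>, so
      every component receives the same total power \<open>d\<close>, and the vanishing of the sum
      at \<open>l n\<close> carries over.\<close>
    have "of_real (1 / real n) ^ (d - m) * Q m (u n) = of_real (1 / real n) ^ d * Q m (l n)" if "m \<le> d" for m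
    proof -
      have "Q m (u n) = of_real (1 / real n) ^ m * Q m (l n)" unfolding u_def by (rule hom)
      moreover have "complex_of_real (1 / real n) ^ (d - m) * of_real (1 / real n) ^ m = of_real (1 / real n) ^ d"
        using that by (simp only: power_add[symmetric] le_add_diff_inverse2)
      ultimately show ?thesis by (simp only: mult.assoc[symmetric])
    qed
    then have "(\<Sum>m\<le>d. of_real (1 / real n) ^ (d - m) * Q m (u n)) = of_real (1 / real n) ^ d * (\<Sum>m\<le>d. Q m (l n))"
      unfolding sum_distrib_left by (intro sum.cong) auto
    then show ?case using zero[OF l(1)] by simp
  qed
  then have "(\<lambda>n. \<Sum>m\<le>d. of_real (1 / real n) ^ (d - m) * Q m (u n)) \<longlonglongrightarrow> 0"
    by (rule tendsto_eventually)
  ultimately have "(\<Sum>m\<le>d. (if m = d then 1 else 0) * Q m w) = 0"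
    by (rule LIMSEQ_unique)
  then show ?thesis by (simp add: if_distrib[of "\<lambda>x. x * _"] cong: if_cong)
qed

text \<open>Once the top component vanishes everywhere, the remaining sum still vanishes on
  \<open>L\<close>, so induction on \<open>d\<close> strips off all components.\<close>

lemma homogeneous_sum_zero_on_relatively_dense:
  fixes Q :: "nat \<Rightarrow> complex \<Rightarrow> complex" and L :: "complex set"
  assumes dense: "\<And>w. \<exists>z\<in>L. dist w z \<le> R"
    and hom: "\<And>m s z. Q m (of_real s * z) = of_real s ^ m * Q m z"
    and cont: "\<And>m. continuous_on UNIV (Q m)"
    and zero: "\<And>z. z \<in> L \<Longrightarrow> (\<Sum>m\<le>d. Q m z) = 0"
  shows "(\<Sum>m\<le>d. Q m z) = 0"
  using zero
proof (induction d arbitrary: z)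
  case 0
  have "Q 0 z = 0" by (rule top_homogeneous_component_zero[OF dense hom cont 0])
  then show ?case by simp
next
  case (Suc d)
  have top: "Q (Suc d) w = 0" for w
    by (rule top_homogeneous_component_zero[OF dense hom cont Suc.prems])
  have "(\<Sum>m\<le>d. Q m z) = 0"
    by (rule Suc.IH) (use Suc.prems top in simp)
  then show ?case using top by simp
qed

lemma poly_eq_sum_atMost:
  fixes p :: "complex poly"
  assumes "degree p \<le> N"
  shows "poly p z = (\<Sum>i\<le>N. coeff p i * z ^ i)"
  unfolding poly_altdef
proof (rule sum.mono_neutral_left)
  show "{..degree p} \<subseteq> {..N}" using assms by simp
qed (auto simp: coeff_eq_0)

text \<open>The difference of the squared moduli is a finite sum of multiples of
  \<open>z ^ j * cnj z ^ k\<close>. Grouping by the total degree \<open>j + k\<close> gives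
  components that are homogeneous under real scaling.\<close>

lemma norm_poly_eq_on_relatively_dense:
  fixes p g :: "complex poly" and L :: "complex set"
  assumes dense: "\<And>w. \<exists>z\<in>L. dist w z \<le> R"
    and eq: "\<And>z. z \<in> L \<Longrightarrow> cmod (poly p z) = cmod (poly g z)"
  shows "cmod (poly p z) = cmod (poly g z)"
proof -
  define N where "N = max (degree p) (degree g)"
  define c where "c j k = coeff p j * cnj (coeff p k) - coeff g j * cnj (coeff g k)" for j k
  define T where "T z = (\<lambda>(j, k). c j k * (z ^ j * cnj z ^ k))" for z
  define Q where "Q m z = (\<Sum>x\<in>{x\<in>{..N} \<times> {..N}. fst x + snd x = m}. T z x)" for m z
  have sq: "of_real ((cmod (poly q z))\<^sup>2) = (\<Sum>(j, k)\<in>{..N} \<times> {..N}. coeff q j * cnj (coeff q k) * (z ^ j * cnj z ^ k))"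
    if "degree q \<le> N" for q :: "complex poly" and z
  proof -
    have "of_real ((cmod (poly q z))\<^sup>2) = poly q z * cnj (poly q z)" by (rule complex_norm_square)
    also have "\<dots> = (\<Sum>i\<le>N. coeff q i * z ^ i) * (\<Sum>i\<le>N. cnj (coeff q i) * cnj z ^ i)"
      unfolding poly_eq_sum_atMost[OF that] by simp
    also have "\<dots> = (\<Sum>(j, k)\<in>{..N} \<times> {..N}. coeff q j * cnj (coeff q k) * (z ^ j * cnj z ^ k))"
      unfolding sum_product sum.cartesian_product by (intro sum.cong refl) (auto simp: mult_ac)
    finally show ?thesis .
  qed
  have sumQ: "(\<Sum>m\<le>2 * N. Q m z) = of_real ((cmod (poly p z))\<^sup>2 - (cmod (poly g z))\<^sup>2)" for z
  proof -
    have "(\<Sum>m\<le>2 * N. Q m z) = (\<Sum>x\<in>{..N} \<times> {..N}. T z x)"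
      unfolding Q_def by (rule sum.group) auto
    also have "\<dots> = of_real ((cmod (poly p z))\<^sup>2 - (cmod (poly g z))\<^sup>2)"
    proof -
      have "degree p \<le> N" "degree g \<le> N" by (simp_all add: N_def)
      show ?thesis
        unfolding of_real_diff sq[OF \<open>degree p \<le> N\<close>] sq[OF \<open>degree g \<le> N\<close>] sum_subtractf[symmetric]
        by (intro sum.cong refl) (auto simp: T_def c_def left_diff_distrib)
    qed
    finally show ?thesis .
  qed
  have "(\<Sum>m\<le>2 * N. Q m z) = 0"
  proof (rule homogeneous_sum_zero_on_relatively_dense[OF dense])
    show "Q m (of_real s * z) = of_real s ^ m * Q m z" for m s z
      unfolding Q_def sum_distrib_left
      by (intro sum.cong refl) (auto simp: T_def power_mult_distrib power_add mult_ac)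
    show "continuous_on UNIV (Q m)" for m
      unfolding Q_def T_def case_prod_beta by (intro continuous_intros)
    show "(\<Sum>m\<le>2 * N. Q m z) = 0" if "z \<in> L" for z
      unfolding sumQ using eq[OF that] by simp
  qed
  then have "(cmod (poly p z))\<^sup>2 = (cmod (poly g z))\<^sup>2"
    unfolding sumQ of_real_eq_0_iff by simp
  then show ?thesis by (rule power2_eq_imp_eq) auto
qed

text \<open>Near a point where \<open>g\<close> does not vanish, \<open>p / g\<close> is holomorphic
  of modulus 1, hence constant by the maximum modulus principle; \<open>p - smult \<sigma> g\<close>
  then has infinitely many roots.\<close>

lemma poly_eq_norm_imp_unimodular_multiple:
  fixes p g :: "complex poly"
  assumes eq: "\<And>z. cmod (poly p z) = cmod (poly g z)"
  obtains \<sigma> where "cmod \<sigma> = 1" "p = smult \<sigma> g"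
proof (cases "g = 0")
  case True
  then have "p = 0" using eq by (simp add: poly_all_0_iff_0[symmetric])
  then show ?thesis using True by (intro that[of 1]) auto
next
  case False
  then obtain a where a: "poly g a \<noteq> 0" using poly_all_0_iff_0 by blast
  have "open {z. poly g z \<noteq> 0}" 
    by (intro open_Collect_neq continuous_intros)
  then obtain e where e: "e > 0" "\<And>z. z \<in> ball a e \<Longrightarrow> poly g z \<noteq> 0"
    using a unfolding open_contains_ball by blast
  have "(\<lambda>z. poly p z / poly g z) constant_on ball a e"
  proof (rule maximum_modulus_principle[where U = "ball a e" and \<xi> = a])
    show "(\<lambda>z. poly p z / poly g z) holomorphic_on ball a e"
      using e by (intro holomorphic_intros) auto
    show "cmod (poly p z / poly g z) \<le> cmod (poly p a / poly g a)" if "z \<in> ball a e" for z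
      using e(2)[OF that] a by (simp add: norm_divide eq)
  qed (use e in auto)
  then obtain \<sigma> where \<sigma>: "\<And>z. z \<in> ball a e \<Longrightarrow> poly p z / poly g z = \<sigma>"
    unfolding constant_on_def by blast
  have "ball a e \<subseteq> {z. poly (p - smult \<sigma> g) z = 0}"
    using \<sigma> e(2) by (force simp: field_simps)
  moreover have "infinite (ball a e)" using uncountable_ball[OF e(1)] countable_finite by blast
  ultimately have "p - smult \<sigma> g = 0" using poly_roots_finite infinite_super by blast
  moreover have "cmod \<sigma> = 1" using \<sigma>[of a] a eq[of a] e(1) by (auto simp: norm_divide)
  ultimately show ?thesis using that by simp
qed

section \<open>Lower type and density as explicit bounds\<close>

lemma norm_le_max_modulus:
  assumes "f holomorphic_on UNIV" "z \<in> cball 0 r"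
  shows "cmod (f z) \<le> max_modulus f r"
proof (rule maximum_modulus_cball[OF assms(1) _ _ assms(2)])
  show "r \<ge> 0" using assms(2) by (auto intro: order.trans[OF norm_ge_zero])
  fix u :: complex assume u: "u \<in> sphere 0 r"
  have "compact ((\<lambda>z. cmod (f z)) ` sphere 0 r)"
    by (intro compact_continuous_image continuous_intros holomorphic_on_imp_continuous_on
          holomorphic_on_subset[OF assms(1)]) auto
  then have "bdd_above ((\<lambda>z. cmod (f z)) ` sphere 0 r)"
    by (intro bounded_imp_bdd_above compact_imp_bounded)
  then show "cmod (f u) \<le> max_modulus f r"
    unfolding max_modulus_def using u by (rule cSUP_upper2) auto
qed

text \<open>For \<open>r \<ge> cmod a\<close> the maximum modulus is at least
  \<open>cmod (f a)\<close>, and a constant divided by \<open>r\<^sup>2\<close> tends to 0.\<close>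

lemma lower_type_nonneg:
  assumes f: "f holomorphic_on UNIV" and a: "f a \<noteq> 0"
  shows "lower_type f \<ge> 0"
proof -
  have "((\<lambda>r. ln (cmod (f a)) / r\<^sup>2) \<longlongrightarrow> 0) at_top" by real_asymp
  then have "((\<lambda>r. ereal (ln (cmod (f a)) / r\<^sup>2)) \<longlongrightarrow> ereal 0) at_top" by (simp only: tendsto_ereal)
  then have "Liminf at_top (\<lambda>r. ereal (ln (cmod (f a)) / r\<^sup>2)) = 0"
    by (metis lim_imp_Liminf trivial_limit_at_top_linorder zero_ereal_def)
  moreover have "Liminf at_top (\<lambda>r. ereal (ln (cmod (f a)) / r\<^sup>2)) \<le> lower_type f"
    unfolding lower_type_def
  proof (rule Liminf_mono)
    show "\<forall>\<^sub>F r in at_top. ereal (ln (cmod (f a)) / r\<^sup>2) \<le> ext_ln (max_modulus f r) / ereal (r\<^sup>2)"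
      using eventually_ge_at_top[of "cmod a"] eventually_gt_at_top[of 0]
    proof eventually_elim
      case (elim r)
      have "cmod (f a) \<le> max_modulus f r" using elim f by (intro norm_le_max_modulus) auto
      moreover have "cmod (f a) > 0" using a by simp
      ultimately have "max_modulus f r \<noteq> 0" "ln (cmod (f a)) \<le> ln (max_modulus f r)"
        by (linarith, intro ln_mono)
      then show ?case using elim by (simp add: ext_ln_def divide_right_mono)
    qed
  qed
  ultimately show ?thesis by simp
qed

text \<open>A lower limit below \<open>\<beta>\<close> controls only arbitrarily large radii, not
  all large ones, hence the frequency quantifier; the maximum principle passes from circle to
  disc.\<close>

lemma lower_type_less_imp_frequently:
  assumes f: "f holomorphic_on UNIV" and \<beta>: "lower_type f < ereal \<beta>"
  shows "\<exists>\<^sub>F r in at_top. \<forall>z\<in>cball 0 r. cmod (f z) \<le> exp (\<beta> * r\<^sup>2)"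
proof -
  have "\<exists>\<^sub>F r in at_top. ext_ln (max_modulus f r) / ereal (r\<^sup>2) < ereal \<beta>"
  proof (rule ccontr)
    assume "\<not> ?thesis"
    then have "\<forall>\<^sub>F r in at_top. ereal \<beta> \<le> ext_ln (max_modulus f r) / ereal (r\<^sup>2)"
      by (simp add: not_frequently not_less)
    then have "ereal \<beta> \<le> lower_type f" unfolding lower_type_def by (rule Liminf_bounded)
    then show False using \<beta> by simp
  qed
  then have "\<exists>\<^sub>F r in at_top. ext_ln (max_modulus f r) / ereal (r\<^sup>2) < ereal \<beta> \<and> r > 0"
    using eventually_gt_at_top[of "0::real"] by (rule frequently_eventually_frequently)
  then show ?thesis
  proof (rule frequently_mono[rotated], intro allI impI ballI)
    fix r :: real and z :: complex
    assume r: "ext_ln (max_modulus f r) / ereal (r\<^sup>2) < ereal \<beta> \<and> r > 0" and z: "z \<in> cball 0 r"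
    have M: "cmod (f z) \<le> max_modulus f r" using f z by (rule norm_le_max_modulus)
    show "cmod (f z) \<le> exp (\<beta> * r\<^sup>2)"
    proof (cases "max_modulus f r = 0")
      \<comment> \<open>Here \<open>ext_ln\<close> is minus infinity and cannot be exponentiated as
        a real number, but \<open>f\<close> vanishes on the whole disc.\<close>
      case True
      then show ?thesis using M order.trans[of _ 0] by simp
    next
      case False
      then have "max_modulus f r > 0" using M order.trans[OF norm_ge_zero] by fastforce
      moreover have "ln (max_modulus f r) / r\<^sup>2 < \<beta>"
        using r False by (auto simp: ext_ln_def)
      then have "ln (max_modulus f r) < \<beta> * r\<^sup>2"
        using r by (simp add: field_simps)
      ultimately have "max_modulus f r \<le> exp (\<beta> * r\<^sup>2)"
        by (metis exp_ln exp_le_cancel_iff less_imp_le)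
      then show ?thesis using M by linarith
    qed
  qed
qed

text \<open>Replacing \<open>t\<close> by \<open>t - s\<close> loses only terms of order
  \<open>t\<close>, which the gap between \<open>2 * b\<close> and \<open>d * pi\<close> absorbs for
  large \<open>t\<close>.\<close>

lemma lower_beurling_density_disc_count:
  assumes "compact K" "measure lborel K = 1" "uniform_discrete L"
    and d: "ereal d < lower_beurling_density K L" and b: "2 * b < d * pi"
  obtains t0 where "t0 > 0" "\<And>w t. t0 \<le> t \<Longrightarrow> 2 * b * t\<^sup>2 \<le> real (card (L \<inter> cball w t))"
proof -
  obtain s where s: "\<And>w t. t \<ge> 0 \<Longrightarrow> d * pi * t\<^sup>2 \<le> real (card (L \<inter> cball w (t + s)))"
    using lower_beurling_density_card_cball[OF assms(1-4)] by blast
  define c where "c = d * pi - 2 * b"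
  have "c > 0" using b by (simp add: c_def)
  have "filterlim (\<lambda>t. (c + 2 * b) * (t - s)\<^sup>2 - 2 * b * t\<^sup>2) at_top at_top"
    using \<open>c > 0\<close> by real_asymp
  then have "\<forall>\<^sub>F t in at_top. (c + 2 * b) * (t - s)\<^sup>2 - 2 * b * t\<^sup>2 \<ge> 0"
    unfolding filterlim_at_top by blast
  then obtain N where N: "\<And>t. t \<ge> N \<Longrightarrow> 2 * b * t\<^sup>2 \<le> d * pi * (t - s)\<^sup>2"
    unfolding eventually_at_top_linorder c_def by auto
  show ?thesis
  proof (rule that[of "max 1 (max N s)"])
    fix w t assume t: "max 1 (max N s) \<le> t"
    then have "2 * b * t\<^sup>2 \<le> d * pi * (t - s)\<^sup>2" by (intro N) auto
    also have "\<dots> \<le> real (card (L \<inter> cball w (t - s + s)))" using t by (intro s) auto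
    finally show "2 * b * t\<^sup>2 \<le> real (card (L \<inter> cball w t))" by simp
  qed simp
qed

section \<open>The zero function and the conclusion\<close>

lemma phase_equiv_zero_iff:
  assumes "infinite L"
  shows "phase_equiv (\<lambda>z. 0) (poly g) \<longleftrightarrow> (\<forall>z\<in>L. cmod 0 = cmod (poly g z))"
proof
  assume "\<forall>z\<in>L. cmod 0 = cmod (poly g z)"
  then have "L \<subseteq> {z. poly g z = 0}" by auto
  then have "g = 0" using assms poly_roots_finite infinite_super by blast
  then show "phase_equiv (\<lambda>z. 0) (poly g)" unfolding phase_equiv_def by (intro exI[of _ 1]) simp
qed (auto simp: phase_equiv_def)

theorem proposition1:
  fixes f :: "complex \<Rightarrow> complex" and g :: "complex poly" and q :: nat
    and K \<Lambda> :: "complex set"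
  assumes "f holomorphic_on UNIV"
    and "lower_type f < \<infinity>"
    and "degree g = q"
    and "infinite \<Lambda>" and "uniform_discrete \<Lambda>"
    and "compact K" and "measure lborel K = 1"
    and "lower_beurling_density K \<Lambda> > 2 * lower_type f / ereal pi"
  shows "((\<exists>c::real. c > 0 \<and> (\<forall>w\<in>\<Lambda>. cmod (f w) \<le> c * cmod (poly g w))) \<longrightarrow>
            (\<exists>p :: complex poly. f = poly p \<and> degree p \<le> q)) \<and>
         (phase_equiv f (poly g) \<longleftrightarrow> (\<forall>w\<in>\<Lambda>. cmod (f w) = cmod (poly g w)))"
proof (cases "\<forall>z. f z = 0")
  \<comment> \<open>The zero function has lower type minus infinity, so there is no real
    \<open>\<tau>\<close> to start from; it is a polynomial outright, and an infinite zero set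
    forces \<open>g = 0\<close>.\<close>
  case True
  then have f0: "f = (\<lambda>z. 0)" by auto
  have "f = poly 0" using f0 by (simp add: fun_eq_iff)
  then have "\<exists>p. f = poly p \<and> degree p \<le> q" by (metis degree_0 le0)
  moreover have "phase_equiv f (poly g) \<longleftrightarrow> (\<forall>w\<in>\<Lambda>. cmod (f w) = cmod (poly g w))"
    unfolding f0 by (rule phase_equiv_zero_iff[OF assms(4)])
  ultimately show ?thesis by blast
next
  case False
  then obtain a where "f a \<noteq> 0" by blast
  then obtain \<tau> where \<tau>: "lower_type f = ereal \<tau>" "\<tau> \<ge> 0"
    using lower_type_nonneg[OF assms(1)] assms(2) by (cases "lower_type f") fastforce+
  have "ereal (2 * \<tau> / pi) < lower_beurling_density K \<Lambda>"
    using assms(8) unfolding \<tau>(1) by simp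
  \<comment> \<open>The chain \<open>\<tau> < \<beta>0 < \<beta> < b < d * pi / 2\<close> is built
    here: \<open>\<beta>0\<close> bounds the growth of \<open>f\<close>, \<open>\<beta>\<close> is
    the weight, \<open>b\<close> the Blaschke decay rate and \<open>d\<close> a density still
    attained.\<close>
  then obtain d where d: "2 * \<tau> / pi < d" "ereal d < lower_beurling_density K \<Lambda>"
    using ereal_dense2 by (metis less_ereal.simps(1))
  then have "\<tau> < d * pi / 2" using pi_gt_zero by (simp add: field_simps)
  then obtain b where b: "\<tau> < b" "b < d * pi / 2" using dense by blast
  then obtain \<beta> where \<beta>: "\<tau> < \<beta>" "\<beta> < b" using dense by blast
  then obtain \<beta>0 where \<beta>0: "\<tau> < \<beta>0" "\<beta>0 < \<beta>" using dense by blast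
  have "2 * b < d * pi" using b(2) by simp
  then obtain t0 where t0: "t0 > 0"
    and count: "\<And>w t. t0 \<le> t \<Longrightarrow> 2 * b * t\<^sup>2 \<le> real (card (\<Lambda> \<inter> cball w t))"
    using lower_beurling_density_disc_count[OF assms(6,7,5) d(2)] by blast
  have growth: "\<exists>\<^sub>F r in at_top. \<forall>z\<in>cball 0 r. cmod (f z) \<le> exp (\<beta>0 * r\<^sup>2)"
    using lower_type_less_imp_frequently[OF assms(1)] \<beta>0(1) \<tau>(1) by simp
  have "0 < \<beta>" using \<tau>(2) \<beta>(1) by simp
  have part1: "\<exists>p. f = poly p \<and> degree p \<le> q"
    if c: "c > 0" "\<forall>w\<in>\<Lambda>. cmod (f w) \<le> c * cmod (poly g w)" for c
  proof -
    obtain p where "f = poly p" "degree p \<le> degree g"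
      by (rule dominated_on_sampling_set_imp_polynomial
        [OF assms(5) \<open>0 < \<beta>\<close> \<beta>0(2) \<beta>(2) t0 count assms(1) growth c(1), of g])
         (use c(2) in auto)
    then show ?thesis using assms(3) by blast
  qed
  \<comment> \<open>The count at radius \<open>t0\<close> is positive since
    \<open>b > \<tau> \<ge> 0\<close>, so every closed disc of that radius meets
    \<open>\<Lambda>\<close>.\<close>
  have dense: "\<exists>z\<in>\<Lambda>. dist w z \<le> t0" for w
  proof -
    have "0 < 2 * b * t0\<^sup>2" using b(1) \<tau>(2) t0 by simp
    also have "\<dots> \<le> real (card (\<Lambda> \<inter> cball w t0))" using count by simp
    finally have "\<Lambda> \<inter> cball w t0 \<noteq> {}" by auto
    then show ?thesis by auto
  qed
  have "phase_equiv f (poly g)" if eq: "\<forall>w\<in>\<Lambda>. cmod (f w) = cmod (poly g w)"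
  proof -
    \<comment> \<open>Equal moduli are domination with constant 1, so \<open>f\<close> is already a
      polynomial.\<close>
    have "\<exists>p. f = poly p \<and> degree p \<le> q" by (rule part1[of 1]) (use eq in simp_all)
    then obtain p where p: "f = poly p" by blast
    have "cmod (poly p z) = cmod (poly g z)" for z
      by (rule norm_poly_eq_on_relatively_dense[OF dense]) (use eq p in simp)
    then obtain \<sigma> where "cmod \<sigma> = 1" "p = smult \<sigma> g"
      using poly_eq_norm_imp_unimodular_multiple by blast
    then show ?thesis unfolding phase_equiv_def p by auto
  qed
  moreover have "\<forall>w\<in>\<Lambda>. cmod (f w) = cmod (poly g w)" if "phase_equiv f (poly g)"
    using that by (auto simp: phase_equiv_def norm_mult)
  ultimately show ?thesis using part1 by blast
qed

end
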